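(* Let $(X,d)$ be a metric space, $p$ a limit point of $X$ and $s_1$ a positive real number. The membership relation $$(\Omega^X_{p,\tilde r},\rho^{s_1})\in\mathfrak M$$ holds for every pretangent space $(\Omega^X_{p,\tilde r},\rho)$ to $X$ at $p$ (every normalizing sequence $\tilde r$ and every choice of maximal self-stable family $\tilde X_{p,\tilde r}$ containing $\tilde p$) if and only if $$\lim_{\substack{x,y,z\to p\\ (x,y,z)\in X^{+3}}}\frac{\Psi(x,y,z)\,s^2(x,z,y)}{\Phi(x,y,z)\,(s_1-s(x,z,y))^2}=\infty,$$ where $\left(\frac{s(x,z,y)}{s_1-s(x,z,y)}\right)^2:=1$ in the case $s(x,z,y)=\infty$.
   Context: Notation: $a\vee b=\max\{a,b\}$, $a\wedge b=\min\{a,b\}$. Pretangent spaces. A normalizing sequence is a sequence $\tilde r=\{r_n\}_{n\in\mathbb N}$ of positive reals with $r_n\to 0$. Let $\tilde X$ be the set of all sequences of points of $X$. Two sequences $\tilde x=\{x_n\},\tilde y=\{y_n\}\in\tilde X$ are mutually stable w.r.t. $\tilde r$ if the finite limit $\tilde d_{\tilde r}(\tilde x,\tilde y):=\lim_{n\to\infty} d(x_n,y_n)/r_n$ exists. A family $\tilde F\subseteq\tilde X$ is self-stable w.r.t. $\tilde r$ if every two of its elements are mutually stable; it is maximal self-stable if it is self-stable and for every $\tilde z\in\tilde X\setminus\tilde F$ there is $\tilde x\in\tilde F$ such that $\tilde x,\tilde z$ are not mutually stable. For $p\in X$, let $\tilde X_{p,\tilde r}$ be a maximal self-stable family containing the constant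 sequence $\tilde p=\{p,p,\dots\}$ (such a family exists, but need not be unique). Then $\tilde d_{\tilde r}$ is a pseudometric on $\tilde X_{p,\tilde r}$. The metric identification $(\Omega^X_{p,\tilde r},\rho)$, i.e. the set of equivalence classes under $\tilde x\sim\tilde y\Leftrightarrow \tilde d_{\tilde r}(\tilde x,\tilde y)=0$ with $\rho(\alpha,\beta)=\tilde d_{\tilde r}(\tilde x,\tilde y)$ for $\tilde x\in\alpha,\tilde y\in\beta$, is called a pretangent space to $X$ at $p$ w.r.t. $\tilde r$. The class $\mathfrak M$. $\mathfrak M$ is the class of all metric spaces $(Y,\delta)$ such that $\delta(x,z)=\delta(x,y)+\delta(y,z)$ holds for all $x,y,z\in Y$ whenever $\delta(x,z)\ge\delta(x,y)\ge\delta(y,z)$. Here $\rho^{s_1}$ is the function $(\alpha,\beta)\mapsto(\rho(\alpha,\beta))^{s_1}$; membership $(\Omega^X_{p,\tilde r},\rho^{s_1})\in\mathfrak M$ means in particular that $\rho^{s_1}$ is a metric. The set $X^{+3}$. $(x,y,z)\in X^{+3}$ if and only if $x,y,z\in X$ and $d(x,z)\ge d(x,y)\ge d(y,z)>0$. The function $s$. For $x,y,z\in X$: if $d(x,z)\vee d(z,y)<d(x,y)$, then $s(x,y,z)$ is the unique solution $s_0\in[1,\infty)$ of the equation $(d(x,z))^{s}+(d(z,y))^{s}=(d(x,y))^{s}$; otherwise $s(x,y,z):=+\infty$. (So $s(x,z,y)$ is the finite root $t$ of $(d(x,y))^t+(d(y,z))^t=(d(x,z))^t$ when $d(x,y)\vee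 d(y,z)<d(x,z)$, and $+\infty$ otherwise.) The functions $F,\Phi,\Psi$ (depending on $d$ and $p$). For $x,y\in X$ set $$F(x,y):=\frac{d(x,y)\,(d(x,p)\wedge d(y,p))}{(d(x,p)\vee d(y,p))^2}\ \text{ if }(x,y)\ne(p,p),\qquad F(p,p):=0.$$ For $x,y,z\in X$ set $\Phi(x,y,z):=F(x,y)\vee F(x,z)\vee F(y,z)$ and $$\Psi(x,y,z):=\frac{d(x,y)\vee d(y,z)\vee d(x,z)}{d(x,y)\wedge d(y,z)\wedge d(z,x)}$$ (with value $\infty$ if the denominator is $0$). Conventions: $\frac1{\Phi}:=\infty$ if $\Phi=0$, and $\frac{s^2}{(s_1-s)^2}:=\infty$ if $s=s_1$; the expression under the limit is the product of the factors $\Psi$, $1/\Phi$, $s^2/(s_1-s)^2$ in $(0,\infty]$. The limit relation means: for every $M>0$ there is $\varepsilon>0$ such that the expression exceeds $M$ for all $(x,y,z)\in X^{+3}$ with $d(x,p),d(y,p),d(z,p)<\varepsilon$. *)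

theory Defs
  imports "HOL-Analysis.Analysis"
begin

section \<open>Pretangent spaces\<close>

definition normalizing :: "(nat \<Rightarrow> real) \<Rightarrow> bool" where
  "normalizing r \<longleftrightarrow> (\<forall>n. 0 < r n) \<and> r \<longlonglongrightarrow> 0"

definition mutually_stable ::
  "(nat \<Rightarrow> real) \<Rightarrow> (nat \<Rightarrow> 'a::metric_space) \<Rightarrow> (nat \<Rightarrow> 'a) \<Rightarrow> bool" where
  "mutually_stable r x y \<longleftrightarrow> convergent (\<lambda>n. dist (x n) (y n) / r n)"

definition dtilde ::
  "(nat \<Rightarrow> real) \<Rightarrow> (nat \<Rightarrow> 'a::metric_space) \<Rightarrow> (nat \<Rightarrow> 'a) \<Rightarrow> real" where
  "dtilde r x y = lim (\<lambda>n. dist (x n) (y n) / r n)"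

definition self_stable :: "(nat \<Rightarrow> real) \<Rightarrow> (nat \<Rightarrow> 'a::metric_space) set \<Rightarrow> bool" where
  "self_stable r S \<longleftrightarrow> (\<forall>x\<in>S. \<forall>y\<in>S. mutually_stable r x y)"

definition maximal_self_stable ::
  "(nat \<Rightarrow> real) \<Rightarrow> (nat \<Rightarrow> 'a::metric_space) set \<Rightarrow> bool" where
  "maximal_self_stable r S \<longleftrightarrow>
     self_stable r S \<and> (\<forall>z. z \<notin> S \<longrightarrow> (\<exists>x\<in>S. \<not> mutually_stable r x z))"

definition pt_space ::
  "(nat \<Rightarrow> real) \<Rightarrow> (nat \<Rightarrow> 'a::metric_space) set \<Rightarrow> (nat \<Rightarrow> 'a) set set" where
  "pt_space r S = S // {(x, y). x \<in> S \<and> y \<in> S \<and> dtilde r x y = 0}"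

definition pt_dist ::
  "(nat \<Rightarrow> real) \<Rightarrow> (nat \<Rightarrow> 'a::metric_space) set \<Rightarrow> (nat \<Rightarrow> 'a) set \<Rightarrow> real" where
  "pt_dist r \<alpha> \<beta> = (THE c. \<forall>x\<in>\<alpha>. \<forall>y\<in>\<beta>. dtilde r x y = c)"

text \<open>\<^const>\<open>Metric_space\<close> demands symmetry and nonnegativity also outside the carrier.
  For powers of \<^const>\<open>pt_dist\<close> this costs nothing: nonnegativity is immediate for
  \<open>powr\<close>, and symmetry holds for arbitrary arguments.\<close>

lemma pt_dist_commute: "pt_dist r \<alpha> \<beta> = pt_dist r \<beta> \<alpha>"
proof -
  have "dtilde r x y = dtilde r y x" for x y :: "nat \<Rightarrow> 'a"
    by (simp add: dtilde_def dist_commute)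
  then have "(\<lambda>c. \<forall>x\<in>\<alpha>. \<forall>y\<in>\<beta>. dtilde r x y = c) = (\<lambda>c. \<forall>x\<in>\<beta>. \<forall>y\<in>\<alpha>. dtilde r x y = c)"
    by (metis (no_types))
  then show ?thesis
    by (simp add: pt_dist_def)
qed

section \<open>The class \<open>\<MM>\<close> of metric spaces\<close>

definition class_M :: "'b set \<Rightarrow> ('b \<Rightarrow> 'b \<Rightarrow> real) \<Rightarrow> bool" where
  "class_M Y \<delta> \<longleftrightarrow> Metric_space Y \<delta> \<and>
     (\<forall>x\<in>Y. \<forall>y\<in>Y. \<forall>z\<in>Y. \<delta> x z \<ge> \<delta> x y \<and> \<delta> x y \<ge> \<delta> y z \<longrightarrow> \<delta> x z = \<delta> x y + \<delta> y z)"

section \<open>The functions entering the limit condition\<close>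

definition Xplus3 :: "('a::metric_space \<times> 'a \<times> 'a) set" where
  "Xplus3 = {(x, y, z). dist x z \<ge> dist x y \<and> dist x y \<ge> dist y z \<and> dist y z > 0}"

text \<open>The third argument is the intermediate point: \<open>s_exp x y z\<close> refers to the side \<open>x y\<close>.\<close>

definition s_exp :: "'a::metric_space \<Rightarrow> 'a \<Rightarrow> 'a \<Rightarrow> ereal" where
  "s_exp x y z =
     (if max (dist x z) (dist z y) < dist x y
      then ereal (THE t. 1 \<le> t \<and> dist x z powr t + dist z y powr t = dist x y powr t)
      else \<infinity>)"

definition F_fun :: "'a::metric_space \<Rightarrow> 'a \<Rightarrow> 'a \<Rightarrow> real" where
  "F_fun p x y =
     (if (x, y) = (p, p) then 0
      else dist x y * min (dist x p) (dist y p) / (max (dist x p) (dist y p))\<^sup>2)"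

definition Phi_fun :: "'a::metric_space \<Rightarrow> 'a \<Rightarrow> 'a \<Rightarrow> 'a \<Rightarrow> real" where
  "Phi_fun p x y z = max (max (F_fun p x y) (F_fun p x z)) (F_fun p y z)"

definition Psi_fun :: "'a::metric_space \<Rightarrow> 'a \<Rightarrow> 'a \<Rightarrow> ereal" where
  "Psi_fun x y z =
     (let m = min (min (dist x y) (dist y z)) (dist z x)
      in if m = 0 then \<infinity> else ereal (max (max (dist x y) (dist y z)) (dist x z) / m))"

definition inv_Phi :: "'a::metric_space \<Rightarrow> 'a \<Rightarrow> 'a \<Rightarrow> 'a \<Rightarrow> ereal" where
  "inv_Phi p x y z = (if Phi_fun p x y z = 0 then \<infinity> else ereal (1 / Phi_fun p x y z))"

definition s_factor :: "real \<Rightarrow> ereal \<Rightarrow> ereal" where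
  "s_factor s1 s =
     (if s = \<infinity> then 1
      else if s = ereal s1 then \<infinity>
      else s\<^sup>2 / (ereal s1 - s)\<^sup>2)"

definition limit_expr :: "'a::metric_space \<Rightarrow> real \<Rightarrow> 'a \<Rightarrow> 'a \<Rightarrow> 'a \<Rightarrow> ereal" where
  "limit_expr p s1 x y z = Psi_fun x y z * inv_Phi p x y z * s_factor s1 (s_exp x z y)"

end

theory Submission
  imports Defs
begin

text \<open>
  Membership of \<open>\<rho>\<^sup>s\<^sup>1\<close> in \<open>\<MM>\<close> says that every three points of the pretangent space whose
  distances satisfy \<open>a \<ge> b \<ge> c > 0\<close> obey \<open>a\<^sup>s\<^sup>1 = b\<^sup>s\<^sup>1 + c\<^sup>s\<^sup>1\<close>
  (\<open>class_M_pt_space_iff\<close>); the axioms of a metric follow from these equations.  Three points of a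
  pretangent space are limits of triangles in \<open>X\<close> rescaled by \<open>1 / r\<^sub>n\<close>, and each of these triangles
  with a strictly longest side satisfies the same equation with its own exponent \<open>s\<^sub>n \<ge> 1\<close>.
  The sum \<open>(b / a)\<^sup>t + (c / a)\<^sup>t\<close> is continuous in all arguments and strictly decreasing in \<open>t\<close>, so,
  as long as the limit triangle does not degenerate, the equation in the limit is equivalent to
  \<open>s\<^sub>n \<rightarrow> s1\<close> (\<open>s_exp_tendsto_iff\<close>), which is in turn equivalent to
  \<open>s\<^sub>n\<^sup>2 / (s1 - s\<^sub>n)\<^sup>2 \<rightarrow> \<infinity>\<close> (\<open>s_factor_tendsto_PInfty_iff\<close>).

  The factors \<open>\<Psi>\<close> and \<open>1 / \<Phi>\<close> single out the triangles that survive in a pretangent space with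
  nonzero sides.  If the rescaled sides and distances to \<open>p\<close> converge and the limit
  triangle has three distinct vertices, then \<open>\<Psi>\<close> converges, and \<open>\<Phi>\<close> has a positive limit because at
  most one vertex is the class of \<open>p\<close>; hence divergence of the whole product forces divergence of
  the \<open>s\<close>-factor, and the equation holds (\<open>limit_expr_large_imp_class_M\<close>).  Conversely, all three
  factors are bounded below by positive constants, so on a sequence of triangles where the product
  stays bounded each factor does.  Bounded \<open>\<Psi>\<close> keeps the shortest side comparable to the longest
  side \<open>D\<^sub>n\<close>, and bounded \<open>1 / \<Phi>\<close> keeps the distances to \<open>p\<close> of order \<open>D\<^sub>n\<close>.  After
  rescaling by \<open>r\<^sub>n = D\<^sub>n\<close> everything converges along a subsequence, the three sequences of
  vertices together with \<open>p\<close> lie in some maximal self-stable family by Zorn's lemma, and the equation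
  assumed for that pretangent space makes the \<open>s\<close>-factor diverge, a contradiction
  (\<open>class_M_imp_limit_expr_large\<close>).
\<close>

section \<open>Pretangent spaces\<close>

lemma dtilde_tendsto:
  assumes "mutually_stable r x y"
  shows "(\<lambda>n. dist (x n) (y n) / r n) \<longlonglongrightarrow> dtilde r x y"
  using assms unfolding mutually_stable_def dtilde_def by (simp add: convergent_LIMSEQ_iff)

lemma dtilde_commute: "dtilde r x y = dtilde r y x"
  by (simp add: dtilde_def dist_commute)

lemma dtilde_refl: "dtilde r x x = 0"
  by (simp add: dtilde_def)

lemma dtilde_nonneg:
  assumes "normalizing r" "mutually_stable r x y"
  shows "0 \<le> dtilde r x y"
  by (rule LIMSEQ_le_const[OF dtilde_tendsto[OF assms(2)]])
     (use assms(1) in \<open>auto simp: normalizing_def less_imp_le\<close>)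

lemma dtilde_triangle:
  assumes "normalizing r" "self_stable r S" "x \<in> S" "y \<in> S" "z \<in> S"
  shows "dtilde r x z \<le> dtilde r x y + dtilde r y z"
proof (rule LIMSEQ_le)
  show "(\<lambda>n. dist (x n) (z n) / r n) \<longlonglongrightarrow> dtilde r x z"
    using assms by (intro dtilde_tendsto) (auto simp: self_stable_def)
  show "(\<lambda>n. dist (x n) (y n) / r n + dist (y n) (z n) / r n) \<longlonglongrightarrow> dtilde r x y + dtilde r y z"
    using assms by (intro tendsto_add dtilde_tendsto) (auto simp: self_stable_def)
  have "dist (x n) (z n) / r n \<le> dist (x n) (y n) / r n + dist (y n) (z n) / r n" for n
    using assms(1) dist_triangle[of "x n" "z n" "y n"]
    by (simp add: normalizing_def divide_right_mono less_imp_le flip: add_divide_distrib)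
  then show "\<exists>N. \<forall>n\<ge>N. dist (x n) (z n) / r n \<le> dist (x n) (y n) / r n + dist (y n) (z n) / r n"
    by blast
qed

text \<open>The metric identification: its classes are the points of the pretangent space.\<close>

definition pt_rel where
  "pt_rel r S = {(x, y). x \<in> S \<and> y \<in> S \<and> dtilde r x y = 0}"

text \<open>By the triangle inequality, moving to representatives at pseudodistance zero changes no
  distance; hence the description in the definition of the quotient distance picks out a unique
  number.\<close>

lemma pt_dist_class:
  assumes r: "normalizing r" and S: "self_stable r S" and x: "x \<in> S" and y: "y \<in> S"
  shows "pt_dist r (pt_rel r S `` {x}) (pt_rel r S `` {y}) = dtilde r x y"
proof -
  have st: "mutually_stable r u v" if "u \<in> S" "v \<in> S" for u v
    using S that by (auto simp: self_stable_def)
  have const: "dtilde r u v = dtilde r x y"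
    if "u \<in> pt_rel r S `` {x}" "v \<in> pt_rel r S `` {y}" for u v
  proof -
    have u: "u \<in> S" "dtilde r x u = 0" "dtilde r u x = 0"
      and v: "v \<in> S" "dtilde r y v = 0" "dtilde r v y = 0"
      using that by (auto simp: pt_rel_def dtilde_commute)
    note tri = dtilde_triangle[OF r S]
    show ?thesis
      using tri[of u x v] tri[of x y v] tri[of x u y] tri[of u v y] u v x y by force
  qed
  have "x \<in> pt_rel r S `` {x}" "y \<in> pt_rel r S `` {y}"
    using x y by (auto simp: pt_rel_def dtilde_refl)
  with const show ?thesis
    unfolding pt_dist_def by (intro the_equality) metis+
qed

lemma pt_rel_class_eq:
  assumes r: "normalizing r" and S: "self_stable r S" and x: "x \<in> S" and y: "y \<in> S"
    and 0: "dtilde r x y = 0"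
  shows "pt_rel r S `` {x} = pt_rel r S `` {y}"
proof -
  have *: "pt_rel r S `` {u} \<subseteq> pt_rel r S `` {v}"
    if u: "u \<in> S" and v: "v \<in> S" and uv: "dtilde r v u = 0" for u v
  proof
    fix w assume "w \<in> pt_rel r S `` {u}"
    then have w: "w \<in> S" "dtilde r u w = 0" by (auto simp: pt_rel_def)
    have "dtilde r v w \<le> 0" using dtilde_triangle[OF r S v u w(1)] uv w by simp
    moreover have "0 \<le> dtilde r v w"
      using S v w by (intro dtilde_nonneg[OF r]) (auto simp: self_stable_def)
    ultimately show "w \<in> pt_rel r S `` {v}" using v w by (auto simp: pt_rel_def)
  qed
  show ?thesis using *[OF x y] *[OF y x] 0 by (simp add: dtilde_commute)
qed

text \<open>The sorted side lengths are expressed through the unsorted ones by maximum, minimum and sum.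
  These are continuous, so when the relabelling depends on the index of a sequence of triangles,
  the sorted side lengths still converge, without passing to a subsequence on which the relabelling
  is constant.\<close>

lemma longest_side_relabelling:
  fixes d :: "'b \<Rightarrow> 'b \<Rightarrow> real"
  assumes "\<And>u v. d u v = d v u"
  obtains u v w where "d u w \<ge> d u v" "d u v \<ge> d v w"
    "d u w = max (max (d x y) (d y z)) (d x z)"
    "d v w = min (min (d x y) (d y z)) (d x z)"
    "d u v = d x y + d y z + d x z - max (max (d x y) (d y z)) (d x z)
       - min (min (d x y) (d y z)) (d x z)"
    "(u, v, w) \<in> {(x, y, z), (x, z, y), (y, x, z), (y, z, x), (z, x, y), (z, y, x)}"
proof -
  have c: "d y x = d x y" "d z y = d y z" "d z x = d x z" using assms by blast+
  consider "d x z \<ge> d x y \<and> d x y \<ge> d y z" | "d x y \<ge> d x z \<and> d x z \<ge> d y z"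
    | "d y z \<ge> d x y \<and> d x y \<ge> d x z" | "d x y \<ge> d y z \<and> d y z \<ge> d x z"
    | "d y z \<ge> d x z \<and> d x z \<ge> d x y" | "d x z \<ge> d y z \<and> d y z \<ge> d x y"
    by linarith
  then show thesis
  proof cases
    case 1 then show ?thesis by (intro that[of x y z]) (auto simp: c)
  next
    case 2 then show ?thesis by (intro that[of x z y]) (auto simp: c)
  next
    case 3 then show ?thesis by (intro that[of y x z]) (auto simp: c)
  next
    case 4 then show ?thesis by (intro that[of y z x]) (auto simp: c)
  next
    case 5 then show ?thesis by (intro that[of z x y]) (auto simp: c)
  next
    case 6 then show ?thesis by (intro that[of z y x]) (auto simp: c)
  qed
qed

text \<open>After ordering its sides, every triple falls under the additivity condition, and additivity
  implies all three triangle inequalities for the power.  Triples with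
  \<open>\<rho>(y, z) = 0\<close> satisfy the equation trivially, which leaves the ones with positive distances.\<close>

lemma class_M_pt_space_iff:
  assumes r: "normalizing r" and S: "self_stable r S" and s1: "s1 > 0"
  shows "class_M (pt_space r S) (\<lambda>\<alpha> \<beta>. pt_dist r \<alpha> \<beta> powr s1) \<longleftrightarrow>
    (\<forall>x\<in>S. \<forall>y\<in>S. \<forall>z\<in>S. dtilde r x z \<ge> dtilde r x y \<and> dtilde r x y \<ge> dtilde r y z
        \<and> dtilde r y z > 0 \<longrightarrow>
      dtilde r x z powr s1 = dtilde r x y powr s1 + dtilde r y z powr s1)"
    (is "class_M ?Y ?\<delta> \<longleftrightarrow> ?R")
proof -
  let ?D = "dtilde r"
  define k where "k x = pt_rel r S `` {x}" for x
  have Y: "?Y = k ` S"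
    unfolding pt_space_def pt_rel_def[symmetric] quotient_def k_def by auto
  have \<delta>: "?\<delta> (k x) (k y) = ?D x y powr s1" if "x \<in> S" "y \<in> S" for x y
    using pt_dist_class[OF r S that] by (simp add: k_def)
  have nn: "0 \<le> ?D x y" if "x \<in> S" "y \<in> S" for x y
    using S that by (intro dtilde_nonneg[OF r]) (auto simp: self_stable_def)
  have mono: "?D x y powr s1 \<le> ?D u v powr s1 \<longleftrightarrow> ?D x y \<le> ?D u v"
    if "x \<in> S" "y \<in> S" "u \<in> S" "v \<in> S" for x y u v
    using nn[of x y] nn[of u v] that s1
    by (metis linorder_not_less powr_less_mono2 powr_mono2 less_imp_le)
  show ?thesis
  proof
    assume M: "class_M ?Y ?\<delta>"
    show ?R
    proof (intro ballI impI)
      fix x y z assume xyz: "x \<in> S" "y \<in> S" "z \<in> S"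
        and h: "?D x z \<ge> ?D x y \<and> ?D x y \<ge> ?D y z \<and> ?D y z > 0"
      from M have M': "\<forall>x\<in>S. \<forall>y\<in>S. \<forall>z\<in>S. ?\<delta> (k x) (k z) \<ge> ?\<delta> (k x) (k y)
          \<and> ?\<delta> (k x) (k y) \<ge> ?\<delta> (k y) (k z) \<longrightarrow>
          ?\<delta> (k x) (k z) = ?\<delta> (k x) (k y) + ?\<delta> (k y) (k z)"
        unfolding class_M_def Y by blast
      show "?D x z powr s1 = ?D x y powr s1 + ?D y z powr s1"
        using M'[rule_format, OF xyz] h xyz by (simp add: \<delta> mono)
    qed
  next
    assume R: ?R
    have add: "?D x z powr s1 = ?D x y powr s1 + ?D y z powr s1"
      if "x \<in> S" "y \<in> S" "z \<in> S" "?D x z \<ge> ?D x y" "?D x y \<ge> ?D y z" for x y z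
    proof (cases "?D y z = 0")
      case True
      then have "?D x z = ?D x y"
        using dtilde_triangle[OF r S that(1,2,3)] that(4) by simp
      then show ?thesis using True by simp
    next
      case False
      then show ?thesis using R that nn[of y z] by force
    qed
    have tri: "?D x z powr s1 \<le> ?D x y powr s1 + ?D y z powr s1"
      if xyz: "x \<in> S" "y \<in> S" "z \<in> S" for x y z
    proof -
      obtain u v w where uvw: "?D u w \<ge> ?D u v" "?D u v \<ge> ?D v w"
        "(u, v, w) \<in> {(x, y, z), (x, z, y), (y, x, z), (y, z, x), (z, x, y), (z, y, x)}"
        by (rule longest_side_relabelling[where d = ?D and x = x and y = y and z = z,
            OF dtilde_commute])
      then have "u \<in> S" "v \<in> S" "w \<in> S" using xyz by auto
      from add[OF this uvw(1,2)]
      have "?D u w powr s1 = ?D u v powr s1 + ?D v w powr s1" .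
      moreover have "?D y x = ?D x y" "?D z y = ?D y z" "?D z x = ?D x z"
        using dtilde_commute by blast+
      moreover have "0 \<le> ?D x y powr s1" "0 \<le> ?D y z powr s1" "0 \<le> ?D x z powr s1" by auto
      ultimately show ?thesis using uvw(3) by (elim insertE) (auto simp del: powr_ge_zero)
    qed
    have "Metric_space ?Y ?\<delta>"
    proof
      show "0 \<le> ?\<delta> \<alpha> \<beta>" for \<alpha> \<beta> by simp
      show "?\<delta> \<alpha> \<beta> = ?\<delta> \<beta> \<alpha>" for \<alpha> \<beta> by (simp add: pt_dist_commute[of r \<alpha> \<beta>])
      show "?\<delta> \<alpha> \<beta> = 0 \<longleftrightarrow> \<alpha> = \<beta>" if ab: "\<alpha> \<in> ?Y" "\<beta> \<in> ?Y" for \<alpha> \<beta>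
      proof -
        from ab obtain x y where xy: "x \<in> S" "y \<in> S" "\<alpha> = k x" "\<beta> = k y"
          unfolding Y by blast
        have "k x = k y" if "?D x y = 0"
          using pt_rel_class_eq[OF r S xy(1,2) that] by (simp add: k_def)
        moreover have "?\<delta> (k x) (k x) = 0"
          using \<delta>[OF xy(1) xy(1)] by (simp add: dtilde_refl)
        ultimately show ?thesis using \<delta>[OF xy(1,2)] xy by auto
      qed
      show "?\<delta> \<alpha> \<gamma> \<le> ?\<delta> \<alpha> \<beta> + ?\<delta> \<beta> \<gamma>" if "\<alpha> \<in> ?Y" "\<beta> \<in> ?Y" "\<gamma> \<in> ?Y" for \<alpha> \<beta> \<gamma>
        using that unfolding Y by (auto simp: \<delta> tri)
    qed
    then show "class_M ?Y ?\<delta>"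
      unfolding class_M_def Y by (auto simp: \<delta> mono add)
  qed
qed

text \<open>Zorn's lemma applies because stability concerns only two sequences at a time, and two members
  of the union of a chain lie in a common member of the chain.\<close>

lemma maximal_self_stable_extension:
  assumes "self_stable r A"
  obtains S where "A \<subseteq> S" "maximal_self_stable r S"
proof -
  let ?P = "{S. A \<subseteq> S \<and> self_stable r S}"
  have "\<exists>S\<in>?P. \<forall>T\<in>?P. S \<subseteq> T \<longrightarrow> T = S"
  proof (rule subset_Zorn)
    fix C assume "subset.chain ?P C"
    then have CP: "\<And>T. T \<in> C \<Longrightarrow> A \<subseteq> T \<and> self_stable r T"
      and lin: "\<And>T1 T2. T1 \<in> C \<Longrightarrow> T2 \<in> C \<Longrightarrow> T1 \<subseteq> T2 \<or> T2 \<subseteq> T1"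
      unfolding subset_chain_def by auto
    show "\<exists>U\<in>?P. \<forall>S\<in>C. S \<subseteq> U"
    proof (cases "C = {}")
      case True then show ?thesis using assms by auto
    next
      case False
      have st: "self_stable r (\<Union>C)"
        unfolding self_stable_def
      proof (intro ballI)
        fix x y assume "x \<in> \<Union>C" "y \<in> \<Union>C"
        then obtain T1 T2 where T: "T1 \<in> C" "x \<in> T1" "T2 \<in> C" "y \<in> T2" by blast
        obtain T where "T \<in> C" "x \<in> T" "y \<in> T" using lin[OF T(1,3)] T by auto
        with CP[of T] show "mutually_stable r x y" by (simp add: self_stable_def)
      qed
      obtain T where "T \<in> C" using False by auto
      then have "A \<subseteq> \<Union>C" using CP[of T] by auto
      with st show ?thesis by (intro bexI[of _ "\<Union>C"]) auto
    qed
  qed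
  then obtain S where "S \<in> ?P" and mx: "\<forall>T\<in>?P. S \<subseteq> T \<longrightarrow> T = S" ..
  then have S: "A \<subseteq> S" "self_stable r S" by simp_all
  have "\<exists>x\<in>S. \<not> mutually_stable r x z" if z: "z \<notin> S" for z
  proof (rule ccontr)
    assume "\<not> ?thesis"
    then have zs: "mutually_stable r x z \<and> mutually_stable r z x" if "x \<in> S" for x
      using that by (simp add: mutually_stable_def dist_commute)
    have "mutually_stable r z z"
      by (simp add: mutually_stable_def convergent_const)
    then have "self_stable r (insert z S)"
      using S(2) zs by (simp add: self_stable_def)
    then have "insert z S = S" using mx S(1) by (simp add: subset_insertI2)
    with z show False by auto
  qed
  with S have "maximal_self_stable r S" unfolding maximal_self_stable_def by blast
  with S(1) show thesis by (rule that)
qed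

section \<open>The exponent of a triangle\<close>

lemma powr_sum_decreasing:
  fixes a b c s t :: real
  assumes "0 < b" "b < a" "0 < c" "c < a" "s < t"
  shows "(b / a) powr t + (c / a) powr t < (b / a) powr s + (c / a) powr s"
  using assms by (intro add_strict_mono powr_less_mono') auto

lemma powr_sum_compare_one:
  fixes a b c t :: real
  assumes "0 < b" "0 < c" "0 < a"
  shows "(b / a) powr t + (c / a) powr t < 1 \<longleftrightarrow> b powr t + c powr t < a powr t"
    and "(b / a) powr t + (c / a) powr t = 1 \<longleftrightarrow> b powr t + c powr t = a powr t"
  using assms by (auto simp: powr_divide divide_simps simp flip: add_divide_distrib)

text \<open>The decreasing function \<open>t \<mapsto> (b / a)\<^sup>t + (c / a)\<^sup>t\<close> is at least \<open>1\<close> at \<open>t = 1\<close> by the triangle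
  inequality and drops below \<open>1\<close> for large \<open>t\<close>.  This justifies the definite description in
  \<^const>\<open>s_exp\<close>.\<close>

lemma ex1_triangle_exponent:
  fixes a b c :: real
  assumes bc: "0 < b" "b < a" "0 < c" "c < a" and tri: "a \<le> b + c"
  shows "\<exists>!t. 1 \<le> t \<and> b powr t + c powr t = a powr t"
proof -
  let ?g = "\<lambda>t. (b / a) powr t + (c / a) powr t"
  have a: "a > 0" using bc by simp
  have "?g \<midarrow>t\<rightarrow> ?g t" for t
    using bc by (intro tendsto_intros) auto
  then have cont: "isCont ?g t" for t by (simp add: isCont_def)
  \<comment> \<open>A point beyond the root: both summands are below one half there.\<close>
  have "\<exists>n. (max b c / a) ^ n < 1/2"
    using bc a by (intro real_arch_pow_inv) auto
  then obtain n where n: "(max b c / a) ^ n < 1/2" by blast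
  define T where "T = max 1 (real n)"
  have "u powr T < 1/2" if "0 < u" "u \<le> max b c / a" for u
  proof -
    have "max b c / a \<le> 1" using bc a by simp
    then have "u \<le> 1" using that by linarith
    then have "u powr T \<le> u powr real n" using that by (intro powr_mono') (auto simp: T_def)
    also have "\<dots> = u ^ n" using that by (simp add: powr_realpow)
    also have "\<dots> \<le> (max b c / a) ^ n" using that by (intro power_mono) auto
    finally show ?thesis using n by simp
  qed
  from this[of "b / a"] this[of "c / a"] have T: "?g T < 1" "1 \<le> T"
    using bc a by (auto simp: T_def divide_right_mono)
  have "?g 1 \<ge> 1" using bc tri a by (simp add: divide_simps flip: add_divide_distrib)
  then obtain t where t: "1 \<le> t" "?g t = 1"
    using IVT2[of ?g T 1 1] T cont by auto
  show ?thesis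
  proof (rule ex1I[of _ t])
    show "1 \<le> t \<and> b powr t + c powr t = a powr t"
      using t powr_sum_compare_one(2)[of b c a t] bc a by simp
    fix u assume "1 \<le> u \<and> b powr u + c powr u = a powr u"
    then have "?g u = 1" using powr_sum_compare_one(2)[of b c a u] bc a by simp
    with t powr_sum_decreasing[OF bc, of u t] powr_sum_decreasing[OF bc, of t u]
    show "u = t" by (cases u t rule: linorder_cases) auto
  qed
qed

lemma s_exp_finite:
  assumes X: "(x, y, z) \<in> Xplus3" and lt: "dist x y < dist x z"
  obtains t where "s_exp x z y = ereal t" "1 \<le> t"
    "dist x y powr t + dist y z powr t = dist x z powr t"
proof -
  let ?P = "\<lambda>t. 1 \<le> t \<and> dist x y powr t + dist y z powr t = dist x z powr t"
  have h: "0 < dist x y" "0 < dist y z" "dist y z < dist x z"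
    using assms by (auto simp: Xplus3_def simp del: zero_less_dist_iff)
  have "\<exists>!t. ?P t"
    using h lt dist_triangle[of x z y] by (intro ex1_triangle_exponent) auto
  then have "?P (THE t. ?P t)" by (rule theI')
  moreover have "s_exp x z y = ereal (THE t. ?P t)"
    using h lt by (simp add: s_exp_def)
  ultimately show thesis using that by blast
qed

lemma s_exp_infinite:
  assumes "(x, y, z) \<in> Xplus3" and "\<not> dist x y < dist x z"
  shows "s_exp x z y = \<infinity>"
  using assms by (auto simp: s_exp_def)

lemma s_exp_ge_1:
  assumes "(x, y, z) \<in> Xplus3"
  shows "1 \<le> s_exp x z y"
proof (cases "dist x y < dist x z")
  case True
  then obtain t where "s_exp x z y = ereal t" "1 \<le> t"
    by (rule s_exp_finite[OF assms])
  then show ?thesis by simp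
next
  case False
  then show ?thesis using s_exp_infinite[OF assms] by simp
qed

lemma triangle_exponent_less_iff:
  fixes a b c s t :: real
  assumes bc: "0 < b" "b < a" "0 < c" "c < a" and s: "b powr s + c powr s = a powr s"
  shows "s < t \<longleftrightarrow> b powr t + c powr t < a powr t"
    and "t < s \<longleftrightarrow> b powr t + c powr t > a powr t"
proof -
  let ?g = "\<lambda>t. (b / a) powr t + (c / a) powr t"
  have a: "0 < a" using bc by simp
  have "?g s = 1" using s powr_sum_compare_one(2)[of b c a s] bc a by simp
  then have "s < t \<longleftrightarrow> ?g t < 1" "s = t \<longleftrightarrow> ?g t = 1"
    using powr_sum_decreasing[OF bc, of s t] powr_sum_decreasing[OF bc, of t s]
    by (cases s t rule: linorder_cases; force)+
  then show "s < t \<longleftrightarrow> b powr t + c powr t < a powr t"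
     "t < s \<longleftrightarrow> b powr t + c powr t > a powr t"
    using powr_sum_compare_one[of b c a t] bc a by force+
qed


lemma s_factor_gt_iff:
  assumes "1 \<le> t" "0 < K"
  shows "ereal K < s_factor s1 (ereal t) \<longleftrightarrow> K * (s1 - t)\<^sup>2 < t\<^sup>2"
proof (cases "t = s1")
  case True
  then show ?thesis using assms by (simp add: s_factor_def)
next
  case False
  then have "s_factor s1 (ereal t) = ereal (t\<^sup>2 / (s1 - t)\<^sup>2)"
    by (simp add: s_factor_def power2_eq_square)
  moreover have "0 < (s1 - t)\<^sup>2" using False by simp
  ultimately show ?thesis by (simp add: pos_less_divide_eq)
qed

text \<open>For finite \<open>s \<ge> 1\<close> one has \<open>\<bar>s1 - s\<bar> \<le> (1 + s1) s\<close>; the value \<open>1\<close> at \<open>s = \<infinity>\<close> obeys the same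
  bound.\<close>

lemma s_factor_lower_bound:
  assumes "0 < s1" "1 \<le> s"
  shows "ereal (1 / (1 + s1)\<^sup>2) \<le> s_factor s1 s"
proof (cases s)
  case (real t)
  then have t: "1 \<le> t" using assms by simp
  show ?thesis
  proof (cases "t = s1")
    case True
    then show ?thesis by (simp add: s_factor_def real)
  next
    case False
    then have eq: "s_factor s1 s = ereal (t\<^sup>2 / (s1 - t)\<^sup>2)"
      by (simp add: s_factor_def power2_eq_square real)
    have "s1 * 1 \<le> s1 * t" using assms t by (intro mult_left_mono) auto
    then have "\<bar>s1 - t\<bar> \<le> (1 + s1) * t"
      using assms(1) t unfolding distrib_right mult_1 mult_1_right by linarith
    then have "\<bar>s1 - t\<bar>\<^sup>2 \<le> ((1 + s1) * t)\<^sup>2" by (intro power_mono) auto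
    then have "1 * (s1 - t)\<^sup>2 \<le> t\<^sup>2 * (1 + s1)\<^sup>2" by (simp add: power_mult_distrib mult.commute)
    moreover have "0 < (s1 - t)\<^sup>2" "0 < (1 + s1)\<^sup>2" using False assms by auto
    ultimately show ?thesis unfolding eq by (simp add: frac_le_eq divide_simps)
  qed
next
  case PInf
  have "1 \<le> (1 + s1)\<^sup>2" using assms by simp
  then show ?thesis using assms by (simp add: PInf s_factor_def)
next
  case MInf
  then show ?thesis using assms by simp
qed

text \<open>For finite \<open>s \<noteq> s1\<close> the \<open>s\<close>-factor equals \<open>1 / (s1 / s - 1)\<^sup>2\<close>, so it is large exactly when
  \<open>s1 / s\<close> is close to \<open>1\<close>; either side of the equivalence makes the terms eventually finite.\<close>

lemma s_factor_tendsto_PInfty_iff: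
  fixes s :: "nat \<Rightarrow> ereal"
  assumes s1: "0 < s1" and ge: "\<forall>\<^sub>F n in sequentially. 1 \<le> s n"
  shows "(\<lambda>n. s_factor s1 (s n)) \<longlonglongrightarrow> \<infinity> \<longleftrightarrow> s \<longlonglongrightarrow> ereal s1"
proof -
  define u where "u n = real_of_ereal (s n)" for n
  have fin: "s n = ereal (u n) \<and> 1 \<le> u n" if "1 \<le> s n" "s n \<noteq> \<infinity>" for n
    using that by (cases "s n") (auto simp: u_def)
  show ?thesis
  proof
    assume L: "(\<lambda>n. s_factor s1 (s n)) \<longlonglongrightarrow> \<infinity>"
    then have big: "\<forall>\<^sub>F n in sequentially. ereal K < s_factor s1 (s n)" for K
      by (auto simp: tendsto_PInfty)
    have ev: "\<forall>\<^sub>F n in sequentially. s n = ereal (u n) \<and> 1 \<le> u n"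
      using big[of 1] ge
    proof eventually_elim
      case (elim n)
      then have "s n \<noteq> \<infinity>" by (auto simp: s_factor_def)
      then show ?case using fin elim by blast
    qed
    have "(\<lambda>n. s1 / u n) \<longlonglongrightarrow> 1"
    proof (rule tendstoI)
      fix e :: real assume e: "0 < e"
      show "\<forall>\<^sub>F n in sequentially. dist (s1 / u n) 1 < e"
        using big[of "1 / e\<^sup>2"] ev
      proof eventually_elim
        case (elim n)
        then have "1 / e\<^sup>2 * (s1 - u n)\<^sup>2 < (u n)\<^sup>2"
          using s_factor_gt_iff[of "u n" "1 / e\<^sup>2" s1] e by simp
        then have "(s1 - u n)\<^sup>2 < (u n)\<^sup>2 * e\<^sup>2"
          using e by (simp add: pos_divide_less_eq)
        then have "\<bar>s1 - u n\<bar>\<^sup>2 < (e * u n)\<^sup>2"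
          by (simp add: power_mult_distrib mult.commute[of "e\<^sup>2"])
        then have "\<bar>s1 - u n\<bar> < e * u n"
          by (rule power2_less_imp_less) (use e elim in simp)
        moreover have "dist (s1 / u n) 1 = \<bar>s1 - u n\<bar> / u n"
          using elim by (simp add: dist_real_def abs_if divide_simps)
        ultimately show ?case using elim by (simp add: pos_divide_less_eq)
      qed
    qed
    then have "(\<lambda>n. s1 / (s1 / u n)) \<longlonglongrightarrow> s1 / 1" by (intro tendsto_intros) auto
    then have "u \<longlonglongrightarrow> s1" using s1 by simp
    then have "(\<lambda>n. ereal (u n)) \<longlonglongrightarrow> ereal s1" by simp
    then show "s \<longlonglongrightarrow> ereal s1"
      by (rule Lim_transform_eventually) (use ev in eventually_elim, simp)
  next
    assume L: "s \<longlonglongrightarrow> ereal s1"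
    then have u: "u \<longlonglongrightarrow> s1" unfolding u_def by (rule lim_real_of_ereal)
    have "\<forall>\<^sub>F n in sequentially. s n < \<infinity>" using L by (rule order_tendstoD) simp
    with ge have ev: "\<forall>\<^sub>F n in sequentially. s n = ereal (u n) \<and> 1 \<le> u n"
      by eventually_elim (use fin in auto)
    have "\<forall>\<^sub>F n in sequentially. ereal K < s_factor s1 (s n)" for K
    proof -
      define K' where "K' = max K 1"
      have "(\<lambda>n. K' * (s1 - u n)\<^sup>2) \<longlonglongrightarrow> K' * (s1 - s1)\<^sup>2"
        by (intro tendsto_intros u)
      then have "\<forall>\<^sub>F n in sequentially. K' * (s1 - u n)\<^sup>2 < 1"
        by (rule order_tendstoD) simp
      with ev show ?thesis
      proof eventually_elim
        case (elim n)
        then have "1 \<le> (u n)\<^sup>2" by simp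
        with elim have "K' * (s1 - u n)\<^sup>2 < (u n)\<^sup>2" by linarith
        moreover have "0 < K'" by (simp add: K'_def)
        ultimately have "ereal K' < s_factor s1 (s n)"
          using elim s_factor_gt_iff[of "u n" K' s1] by simp
        moreover have "ereal K \<le> ereal K'" by (simp add: K'_def)
        ultimately show ?case by (rule order.strict_trans1[rotated])
      qed
    qed
    then show "(\<lambda>n. s_factor s1 (s n)) \<longlonglongrightarrow> \<infinity>" by (simp add: tendsto_PInfty)
  qed
qed

text \<open>If the exponents converge, their equations pass to the limit by continuity of \<open>powr\<close>.
  If the limit equation holds, then \<open>b < a\<close> because \<open>c > 0\<close>, and for \<open>t\<close> on either side of \<open>s1\<close> the
  strict inequality between \<open>a\<^sup>t\<close> and \<open>b\<^sup>t + c\<^sup>t\<close> is inherited by the approximating triangles;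
  by monotonicity it locates their exponents on the same side of \<open>t\<close> as \<open>s1\<close>.\<close>

lemma s_exp_tendsto_iff:
  assumes X: "\<forall>\<^sub>F n in sequentially. (x n, y n, z n) \<in> Xplus3"
    and r: "\<And>n. 0 < r n" and s1: "0 < s1"
    and a: "(\<lambda>n. dist (x n) (z n) / r n) \<longlonglongrightarrow> a"
    and b: "(\<lambda>n. dist (x n) (y n) / r n) \<longlonglongrightarrow> b"
    and c: "(\<lambda>n. dist (y n) (z n) / r n) \<longlonglongrightarrow> c" and c0: "0 < c"
  shows "(\<lambda>n. s_exp (x n) (z n) (y n)) \<longlonglongrightarrow> ereal s1 \<longleftrightarrow> a powr s1 = b powr s1 + c powr s1"
proof -
  define u where "u n = real_of_ereal (s_exp (x n) (z n) (y n))" for n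
  define f g h where "f n = dist (x n) (z n) / r n" and "g n = dist (x n) (y n) / r n"
    and "h n = dist (y n) (z n) / r n" for n
  have lims: "f \<longlonglongrightarrow> a" "g \<longlonglongrightarrow> b" "h \<longlonglongrightarrow> c"
    using a b c by (simp_all add: f_def[abs_def] g_def[abs_def] h_def[abs_def])
  have ord: "\<forall>\<^sub>F n in sequentially. 0 < h n \<and> h n \<le> g n \<and> g n \<le> f n"
    using X by eventually_elim
      (use r in \<open>auto simp: Xplus3_def f_def g_def h_def divide_right_mono less_imp_le\<close>)
  have "c \<le> b"
    by (rule tendsto_le[OF sequentially_bot lims(2,3)]) (use ord in eventually_elim, simp)
  moreover have "b \<le> a"
    by (rule tendsto_le[OF sequentially_bot lims(1,2)]) (use ord in eventually_elim, simp)
  ultimately have abc: "0 < b" "0 < a" "c \<le> b" "b \<le> a" using c0 by auto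
  have fin: "s_exp (x n) (z n) (y n) = ereal (u n) \<and> g n powr u n + h n powr u n = f n powr u n"
    if Xn: "(x n, y n, z n) \<in> Xplus3" and lt: "g n < f n" for n
  proof -
    have "dist (x n) (y n) < dist (x n) (z n)"
      using lt r[of n] by (simp add: f_def g_def divide_less_cancel)
    then obtain t where t: "s_exp (x n) (z n) (y n) = ereal t"
      "dist (x n) (y n) powr t + dist (y n) (z n) powr t = dist (x n) (z n) powr t"
      by (rule s_exp_finite[OF Xn])
    then have "u n = t" by (simp add: u_def)
    with t r[of n] show ?thesis
      by (simp add: f_def g_def h_def powr_divide flip: add_divide_distrib)
  qed
  show ?thesis
  proof
    assume L: "(\<lambda>n. s_exp (x n) (z n) (y n)) \<longlonglongrightarrow> ereal s1"
    then have u: "u \<longlonglongrightarrow> s1" unfolding u_def by (rule lim_real_of_ereal)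
    have "\<forall>\<^sub>F n in sequentially. s_exp (x n) (z n) (y n) < \<infinity>"
      using L by (rule order_tendstoD) simp
    with X have eq: "\<forall>\<^sub>F n in sequentially. f n powr u n = g n powr u n + h n powr u n"
    proof eventually_elim
      case (elim n)
      then have "dist (x n) (y n) < dist (x n) (z n)" using s_exp_infinite by force
      then have "g n < f n" using r[of n] by (simp add: f_def g_def divide_strict_right_mono)
      then show ?case using fin elim by simp
    qed
    have "(\<lambda>n. g n powr u n + h n powr u n) \<longlonglongrightarrow> b powr s1 + c powr s1"
      using abc c0 by (intro tendsto_intros lims u) auto
    moreover have "(\<lambda>n. f n powr u n) \<longlonglongrightarrow> a powr s1"
      using abc by (intro tendsto_intros lims u) auto
    then have "(\<lambda>n. g n powr u n + h n powr u n) \<longlonglongrightarrow> a powr s1"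
      by (rule Lim_transform_eventually) (rule eq)
    ultimately show "a powr s1 = b powr s1 + c powr s1" by (rule LIMSEQ_unique[symmetric])
  next
    assume eq: "a powr s1 = b powr s1 + c powr s1"
    have "0 < c powr s1" using c0 by simp
    then have "b \<noteq> a" using eq by auto
    then have ba: "b < a" "c < a" using abc by auto
    have "\<forall>\<^sub>F n in sequentially. 0 < f n - g n"
      using tendsto_diff[OF lims(1,2)] by (rule order_tendstoD) (use ba in simp)
    with X ord have ev: "\<forall>\<^sub>F n in sequentially. s_exp (x n) (z n) (y n) = ereal (u n) \<and>
        g n powr u n + h n powr u n = f n powr u n \<and> 0 < g n \<and> g n < f n \<and> 0 < h n \<and> h n < f n"
    proof eventually_elim
      case (elim n)
      then have "g n < f n" by simp
      from fin[OF elim(1) this] elim(2) this show ?case by auto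
    qed
    have diff: "(\<lambda>n. f n powr t - (g n powr t + h n powr t)) \<longlonglongrightarrow> a powr t - (b powr t + c powr t)" for t
      using abc c0 by (intro tendsto_intros lims) auto
    have "u \<longlonglongrightarrow> s1"
    proof (rule order_tendstoI)
      fix t assume "t < s1"
      then have "a powr t - (b powr t + c powr t) < 0"
        using triangle_exponent_less_iff(2)[of b a c s1 t] abc ba c0 eq by simp
      with diff have "\<forall>\<^sub>F n in sequentially. f n powr t - (g n powr t + h n powr t) < 0"
        by (rule order_tendstoD)
      with ev show "\<forall>\<^sub>F n in sequentially. t < u n"
      proof eventually_elim
        case (elim n)
        then show ?case using triangle_exponent_less_iff(2)[of "g n" "f n" "h n" "u n" t] by simp
      qed
    next
      fix t assume "s1 < t"
      then have "a powr t - (b powr t + c powr t) > 0"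
        using triangle_exponent_less_iff(1)[of b a c s1 t] abc ba c0 eq by simp
      with diff have "\<forall>\<^sub>F n in sequentially. f n powr t - (g n powr t + h n powr t) > 0"
        by (rule order_tendstoD)
      with ev show "\<forall>\<^sub>F n in sequentially. u n < t"
      proof eventually_elim
        case (elim n)
        then show ?case using triangle_exponent_less_iff(1)[of "g n" "f n" "h n" "u n" t] by simp
      qed
    qed
    then have "(\<lambda>n. ereal (u n)) \<longlonglongrightarrow> ereal s1" by simp
    then show "(\<lambda>n. s_exp (x n) (z n) (y n)) \<longlonglongrightarrow> ereal s1"
      by (rule Lim_transform_eventually) (use ev in eventually_elim, simp)
  qed
qed

section \<open>The factors depending on the position of a triangle\<close>

lemma F_fun_commute: "F_fun p x y = F_fun p y x"
  by (auto simp: F_fun_def dist_commute min.commute max.commute)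

lemma F_fun_pos: "x \<noteq> y \<Longrightarrow> x \<noteq> p \<Longrightarrow> y \<noteq> p \<Longrightarrow> 0 < F_fun p x y"
  by (auto simp: F_fun_def max_def min_def intro!: divide_pos_pos mult_pos_pos)

text \<open>Since the minimum is at most the maximum, \<open>F(x, y)\<close> is at most the distance of \<open>x\<close> and \<open>y\<close>
  relative to their larger distance from \<open>p\<close>.\<close>

lemma F_fun_mult_max_le:
  "F_fun p x y * max (dist x p) (dist y p) \<le> dist x y"
proof (cases "(x, y) = (p, p)")
  case False
  define m where "m = max (dist x p) (dist y p)"
  have m: "0 < m" using False by (auto simp: m_def less_max_iff_disj)
  have "F_fun p x y * m = dist x y * (min (dist x p) (dist y p) / m)"
    using False m by (simp add: F_fun_def m_def[symmetric] power2_eq_square)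
  also have "\<dots> \<le> dist x y * 1"
    using m by (intro mult_left_mono) (auto simp: m_def)
  finally show ?thesis by (simp add: m_def)
qed (auto simp: F_fun_def)

lemma F_fun_le_2: "F_fun p x y \<le> 2"
proof (cases "(x, y) = (p, p)")
  case False
  define m where "m = max (dist x p) (dist y p)"
  have m: "0 < m" using False by (auto simp: m_def less_max_iff_disj)
  have "dist x y \<le> 2 * m" using dist_triangle2[of x y p] by (simp add: m_def)
  with F_fun_mult_max_le[of p x y] have "F_fun p x y * m \<le> 2 * m" by (simp add: m_def)
  then show ?thesis using m by simp
qed (auto simp: F_fun_def)

lemma Phi_fun_le_2: "Phi_fun p x y z \<le> 2"
  by (simp add: Phi_fun_def F_fun_le_2)

lemma Phi_fun_pos:
  assumes "(x, y, z) \<in> Xplus3"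
  shows "0 < Phi_fun p x y z"
proof -
  have "x \<noteq> y" "y \<noteq> z" "x \<noteq> z" using assms by (auto simp: Xplus3_def)
  then consider "x \<noteq> p \<and> y \<noteq> p" | "x \<noteq> p \<and> z \<noteq> p" | "y \<noteq> p \<and> z \<noteq> p" by auto
  then show ?thesis
    by cases (use F_fun_pos \<open>x \<noteq> y\<close> \<open>y \<noteq> z\<close> \<open>x \<noteq> z\<close> in \<open>auto simp: Phi_fun_def less_max_iff_disj\<close>)
qed

lemma Phi_fun_relabel:
  assumes "(u, v, w) \<in> {(x, y, z), (x, z, y), (y, x, z), (y, z, x), (z, x, y), (z, y, x)}"
  shows "Phi_fun p u v w = Phi_fun p x y z"
proof -
  have "F_fun p y x = F_fun p x y" "F_fun p z x = F_fun p x z" "F_fun p z y = F_fun p y z"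
    using F_fun_commute by blast+
  with assms show ?thesis
    by (elim insertE) (simp_all add: Phi_fun_def max.commute max.left_commute)
qed

text \<open>A lower bound for \<open>\<Phi>\<close> keeps the triangle at a distance from \<open>p\<close> comparable to its size:
  two vertices realising \<open>\<Phi>\<close> lie within \<open>dist x z / \<Phi>\<close> of \<open>p\<close>, and the third is at most the
  longest side away from them.\<close>

lemma dist_le_Phi_fun:
  assumes X: "(x, y, z) \<in> Xplus3" and w: "w \<in> {x, y, z}"
  shows "dist w p \<le> (1 + 1 / Phi_fun p x y z) * dist x z"
proof -
  have diam: "dist u v \<le> dist x z" if "u \<in> {x, y, z}" "v \<in> {x, y, z}" for u v
    using X that by (auto simp: Xplus3_def dist_commute)
  have "Phi_fun p x y z \<in> {F_fun p x y, F_fun p x z, F_fun p y z}"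
    by (auto simp: Phi_fun_def max_def)
  then obtain u v where uv: "u \<in> {x, y, z}" "v \<in> {x, y, z}" "Phi_fun p x y z = F_fun p u v"
    by auto
  let ?c = "Phi_fun p x y z"
  have c: "0 < ?c" using Phi_fun_pos[OF X] .
  have "?c * dist u p \<le> ?c * max (dist u p) (dist v p)" using c by (intro mult_left_mono) auto
  also have "\<dots> \<le> dist u v" using F_fun_mult_max_le[of p u v] by (simp add: uv(3))
  also have "\<dots> \<le> dist x z" using uv by (intro diam)
  finally have "dist u p \<le> dist x z / ?c" using c by (simp add: pos_le_divide_eq mult.commute)
  moreover have "dist w p \<le> dist w u + dist u p" by (rule dist_triangle)
  moreover have "dist w u \<le> dist x z" using w uv by (intro diam)
  ultimately show ?thesis by (simp add: algebra_simps)
qed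

lemma limit_expr_Xplus3:
  assumes "(x, y, z) \<in> Xplus3"
  shows "limit_expr p s1 x y z =
    ereal (dist x z / dist y z / Phi_fun p x y z) * s_factor s1 (s_exp x z y)"
proof -
  have h: "dist y z \<le> dist x y" "dist x y \<le> dist x z" "0 < dist y z"
    using assms by (auto simp: Xplus3_def)
  then have "min (min (dist x y) (dist y z)) (dist z x) = dist y z"
    "max (max (dist x y) (dist y z)) (dist x z) = dist x z"
    by (auto simp: dist_commute)
  then have "Psi_fun x y z = ereal (dist x z / dist y z)" using h(3) by (simp add: Psi_fun_def)
  then show ?thesis using Phi_fun_pos[OF assms, of p] by (simp add: limit_expr_def inv_Phi_def)
qed

text \<open>\<open>F\<close> is homogeneous of degree zero, so it may be computed from the rescaled distances.  The
  denominator has a nonzero limit, since two points at positive distance cannot both be at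
  distance zero from \<open>p\<close>.\<close>

lemma F_fun_tendsto:
  assumes r: "\<And>n. 0 < r n"
    and d: "(\<lambda>n. dist (x n) (y n) / r n) \<longlonglongrightarrow> d" "0 < d"
    and u: "(\<lambda>n. dist (x n) p / r n) \<longlonglongrightarrow> u"
    and v: "(\<lambda>n. dist (y n) p / r n) \<longlonglongrightarrow> v"
  shows "(\<lambda>n. F_fun p (x n) (y n)) \<longlonglongrightarrow> d * min u v / (max u v)\<^sup>2"
proof -
  have "d \<le> u + v"
  proof (rule LIMSEQ_le[OF d(1) tendsto_add[OF u v]])
    show "\<exists>N. \<forall>n\<ge>N. dist (x n) (y n) / r n \<le> dist (x n) p / r n + dist (y n) p / r n"
      using r by (auto simp: divide_right_mono less_imp_le dist_triangle2 simp flip: add_divide_distrib)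
  qed
  then have "max u v \<noteq> 0" using d(2) by auto
  then have "(\<lambda>n. dist (x n) (y n) / r n * min (dist (x n) p / r n) (dist (y n) p / r n)
      / (max (dist (x n) p / r n) (dist (y n) p / r n))\<^sup>2) \<longlonglongrightarrow> d * min u v / (max u v)\<^sup>2"
    by (intro tendsto_intros d u v) auto
  moreover have "dist (x n) (y n) / r n * min (dist (x n) p / r n) (dist (y n) p / r n)
      / (max (dist (x n) p / r n) (dist (y n) p / r n))\<^sup>2 = F_fun p (x n) (y n)" for n
  proof -
    have "min (dist (x n) p / r n) (dist (y n) p / r n) = min (dist (x n) p) (dist (y n) p) / r n"
      "max (dist (x n) p / r n) (dist (y n) p / r n) = max (dist (x n) p) (dist (y n) p) / r n"
      using r[of n] by (auto simp: min_def max_def divide_le_cancel)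
    then show ?thesis using r[of n] by (simp add: F_fun_def power2_eq_square)
  qed
  ultimately show ?thesis by simp
qed


section \<open>The criterion\<close>

text \<open>The order of the limit distances need not be the order of the actual ones when two limits
  coincide, so the vertices are relabelled separately for each index.\<close>

lemma limit_expr_large_imp_class_M:
  fixes p :: "'a::metric_space"
  assumes s1: "0 < s1"
    and L: "\<And>M. 0 < M \<Longrightarrow> \<exists>\<epsilon>>0. \<forall>x y z. (x, y, z) \<in> Xplus3 \<and>
            dist x p < \<epsilon> \<and> dist y p < \<epsilon> \<and> dist z p < \<epsilon> \<longrightarrow> limit_expr p s1 x y z > ereal M"
    and r: "normalizing r" and S: "self_stable r S" and pS: "(\<lambda>_. p) \<in> S"
  shows "class_M (pt_space r S) (\<lambda>\<alpha> \<beta>. pt_dist r \<alpha> \<beta> powr s1)"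
  unfolding class_M_pt_space_iff[OF r S s1]
proof (intro ballI impI)
  let ?D = "dtilde r"
  fix x y z assume xyz: "x \<in> S" "y \<in> S" "z \<in> S"
    and "?D x z \<ge> ?D x y \<and> ?D x y \<ge> ?D y z \<and> ?D y z > 0"
  then have ord: "?D x y \<le> ?D x z" "?D y z \<le> ?D x y" "0 < ?D y z" by auto
  have rn: "0 < r n" for n using r by (simp add: normalizing_def)
  have r0: "r \<longlonglongrightarrow> 0" using r by (simp add: normalizing_def)
  have lim: "(\<lambda>n. dist (f n) (g n) / r n) \<longlonglongrightarrow> ?D f g" if "f \<in> S" "g \<in> S" for f g
    using S that by (intro dtilde_tendsto) (auto simp: self_stable_def)
  have limp: "(\<lambda>n. dist (f n) p / r n) \<longlonglongrightarrow> ?D f (\<lambda>_. p)" if "f \<in> S" for f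
    using lim[OF that pS] .
  have "\<exists>u v w. (u, v, w) \<in> {(x n, y n, z n), (x n, z n, y n), (y n, x n, z n), (y n, z n, x n),
        (z n, x n, y n), (z n, y n, x n)} \<and> dist v w / r n \<le> dist u v / r n \<and>
      dist u v / r n \<le> dist u w / r n \<and>
      dist u w / r n = max (max (dist (x n) (y n) / r n) (dist (y n) (z n) / r n)) (dist (x n) (z n) / r n) \<and>
      dist v w / r n = min (min (dist (x n) (y n) / r n) (dist (y n) (z n) / r n)) (dist (x n) (z n) / r n) \<and>
      dist u v / r n = dist (x n) (y n) / r n + dist (y n) (z n) / r n + dist (x n) (z n) / r n
        - max (max (dist (x n) (y n) / r n) (dist (y n) (z n) / r n)) (dist (x n) (z n) / r n)
        - min (min (dist (x n) (y n) / r n) (dist (y n) (z n) / r n)) (dist (x n) (z n) / r n)" for n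
    by (rule longest_side_relabelling[where d = "\<lambda>a b. dist a b / r n" and x = "x n" and y = "y n"
          and z = "z n"]) (simp add: dist_commute, blast)
  then obtain u v w where uvw: "\<And>n. (u n, v n, w n) \<in> {(x n, y n, z n), (x n, z n, y n),
        (y n, x n, z n), (y n, z n, x n), (z n, x n, y n), (z n, y n, x n)}"
    and o: "\<And>n. dist (v n) (w n) / r n \<le> dist (u n) (v n) / r n"
      "\<And>n. dist (u n) (v n) / r n \<le> dist (u n) (w n) / r n"
    and uw: "\<And>n. dist (u n) (w n) / r n =
      max (max (dist (x n) (y n) / r n) (dist (y n) (z n) / r n)) (dist (x n) (z n) / r n)"
    and vw: "\<And>n. dist (v n) (w n) / r n =
      min (min (dist (x n) (y n) / r n) (dist (y n) (z n) / r n)) (dist (x n) (z n) / r n)"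
    and uv: "\<And>n. dist (u n) (v n) / r n =
      dist (x n) (y n) / r n + dist (y n) (z n) / r n + dist (x n) (z n) / r n
        - max (max (dist (x n) (y n) / r n) (dist (y n) (z n) / r n)) (dist (x n) (z n) / r n)
        - min (min (dist (x n) (y n) / r n) (dist (y n) (z n) / r n)) (dist (x n) (z n) / r n)"
    by metis
  have mx: "max (max (?D x y) (?D y z)) (?D x z) = ?D x z"
    and mn: "min (min (?D x y) (?D y z)) (?D x z) = ?D y z" using ord by auto
  have "(\<lambda>n. dist (u n) (w n) / r n) \<longlonglongrightarrow> max (max (?D x y) (?D y z)) (?D x z)"
    unfolding uw by (intro tendsto_max lim xyz)
  then have lxz: "(\<lambda>n. dist (u n) (w n) / r n) \<longlonglongrightarrow> ?D x z" by (simp only: mx)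
  have "(\<lambda>n. dist (v n) (w n) / r n) \<longlonglongrightarrow> min (min (?D x y) (?D y z)) (?D x z)"
    unfolding vw by (intro tendsto_min lim xyz)
  then have lyz: "(\<lambda>n. dist (v n) (w n) / r n) \<longlonglongrightarrow> ?D y z" by (simp only: mn)
  have "(\<lambda>n. dist (u n) (v n) / r n) \<longlonglongrightarrow> ?D x y + ?D y z + ?D x z -
      max (max (?D x y) (?D y z)) (?D x z) - min (min (?D x y) (?D y z)) (?D x z)"
    unfolding uv by (intro tendsto_diff tendsto_add tendsto_max tendsto_min lim xyz)
  then have lxy: "(\<lambda>n. dist (u n) (v n) / r n) \<longlonglongrightarrow> ?D x y" by (simp add: mx mn)

  have "\<forall>\<^sub>F n in sequentially. 0 < dist (v n) (w n) / r n"
    using lyz ord(3) by (rule order_tendstoD)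
  then have X: "\<forall>\<^sub>F n in sequentially. (u n, v n, w n) \<in> Xplus3"
  proof eventually_elim
    case (elim n)
    with o[of n] rn[of n] show ?case
      by (simp add: Xplus3_def divide_le_cancel zero_less_divide_iff del: zero_less_dist_iff)
  qed

  \<comment> \<open>The limit of the symmetric factor \<open>\<Phi>\<close>; at most one of the three limit points is the class
    of \<open>p\<close>, so at least one of the three terms is positive.\<close>
  let ?p = "\<lambda>_::nat. p"
  define F where "F d a b = d * min a b / (max a b)\<^sup>2" for d a b :: real
  define \<Phi> where "\<Phi> = max (max (F (?D x y) (?D x ?p) (?D y ?p)) (F (?D x z) (?D x ?p) (?D z ?p)))
    (F (?D y z) (?D y ?p) (?D z ?p))"
  have "(\<lambda>n. Phi_fun p (x n) (y n) (z n)) \<longlonglongrightarrow> \<Phi>"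
    unfolding Phi_fun_def \<Phi>_def F_def
    by (intro tendsto_max F_fun_tendsto[of r] lim limp xyz rn) (use ord in auto)
  then have lPhi: "(\<lambda>n. Phi_fun p (u n) (v n) (w n)) \<longlonglongrightarrow> \<Phi>"
    using Phi_fun_relabel[OF uvw] by simp
  have nn: "0 \<le> ?D f ?p" if "f \<in> S" for f
    using S that pS by (intro dtilde_nonneg[OF r]) (auto simp: self_stable_def)
  have Fpos: "0 < F d a b" if "0 < d" "0 < a" "0 < b" for d a b
    using that by (auto simp: F_def min_def max_def)
  have tri: "?D f g \<le> ?D f ?p + ?D g ?p" if "f \<in> S" "g \<in> S" for f g
    using dtilde_triangle[OF r S that(1) pS that(2)] by (simp add: dtilde_commute)
  have "\<Phi> > 0"
  proof -
    consider "0 < ?D x ?p \<and> 0 < ?D y ?p" | "0 < ?D x ?p \<and> 0 < ?D z ?p" | "0 < ?D y ?p \<and> 0 < ?D z ?p"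
      using tri[OF xyz(1,2)] tri[OF xyz(2,3)] tri[OF xyz(1,3)] nn[OF xyz(1)] nn[OF xyz(2)]
        nn[OF xyz(3)] ord by linarith
    then show ?thesis
      by cases (use ord Fpos in \<open>auto simp: \<Phi>_def less_max_iff_disj\<close>)
  qed
  define G where "G n = dist (u n) (w n) / dist (v n) (w n) / Phi_fun p (u n) (v n) (w n)" for n
  have "(\<lambda>n. dist (u n) (w n) / r n / (dist (v n) (w n) / r n) / Phi_fun p (u n) (v n) (w n))
      \<longlonglongrightarrow> ?D x z / ?D y z / \<Phi>"
    using \<open>\<Phi> > 0\<close> ord by (intro tendsto_intros lxz lyz lPhi) auto
  moreover have "dist (u n) (w n) / r n / (dist (v n) (w n) / r n) / Phi_fun p (u n) (v n) (w n) = G n"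
    for n using rn[of n] by (simp add: G_def)
  ultimately have lG: "G \<longlonglongrightarrow> ?D x z / ?D y z / \<Phi>" by simp
  define K where "K = ?D x z / ?D y z / \<Phi> + 1"
  have "0 \<le> ?D x z / ?D y z / \<Phi>" using ord \<open>\<Phi> > 0\<close> by simp
  then have K: "0 < K" unfolding K_def by linarith
  have GK: "\<forall>\<^sub>F n in sequentially. G n < K"
    using lG by (rule order_tendstoD) (simp add: K_def)

  have small: "\<forall>\<^sub>F n in sequentially. dist (f n) p < \<epsilon>" if "f \<in> S" "0 < \<epsilon>" for f \<epsilon>
  proof -
    have "(\<lambda>n. dist (f n) p / r n * r n) \<longlonglongrightarrow> ?D f ?p * 0"
      by (intro tendsto_mult limp that r0)
    moreover have "dist (f n) p / r n * r n = dist (f n) p" for n using rn[of n] by simp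
    ultimately have "(\<lambda>n. dist (f n) p) \<longlonglongrightarrow> 0" by simp
    then show ?thesis using that(2) by (rule order_tendstoD)
  qed
  have "\<forall>\<^sub>F n in sequentially. ereal M < s_factor s1 (s_exp (u n) (w n) (v n))" for M
  proof -
    define M' where "M' = max M 1"
    have M': "0 < M'" by (simp add: M'_def)
    with K have "0 < K * M'" by simp
    from L[OF this] obtain \<epsilon> where \<epsilon>: "\<epsilon> > 0"
      and big: "\<And>x y z. (x, y, z) \<in> Xplus3 \<Longrightarrow> dist x p < \<epsilon> \<Longrightarrow> dist y p < \<epsilon> \<Longrightarrow> dist z p < \<epsilon>
        \<Longrightarrow> limit_expr p s1 x y z > ereal (K * M')" by blast
    show ?thesis
      using X GK small[OF xyz(1) \<epsilon>] small[OF xyz(2) \<epsilon>] small[OF xyz(3) \<epsilon>]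
    proof eventually_elim
      case (elim n)
      then have "dist (u n) p < \<epsilon>" "dist (v n) p < \<epsilon>" "dist (w n) p < \<epsilon>"
        using uvw[of n] by auto
      with big elim have "ereal (K * M') < limit_expr p s1 (u n) (v n) (w n)" by blast
      also have "\<dots> = ereal (G n) * s_factor s1 (s_exp (u n) (w n) (v n))"
        using elim by (simp add: limit_expr_Xplus3 G_def)
      also have "\<dots> \<le> ereal K * s_factor s1 (s_exp (u n) (w n) (v n))"
      proof (rule ereal_mult_right_mono)
        have "0 \<le> ereal (1 / (1 + s1)\<^sup>2)" using s1 by simp
        also have "\<dots> \<le> s_factor s1 (s_exp (u n) (w n) (v n))"
          by (intro s_factor_lower_bound s1 s_exp_ge_1 elim)
        finally show "0 \<le> s_factor s1 (s_exp (u n) (w n) (v n))" .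
      qed (use elim in simp)
      finally have "ereal M' < s_factor s1 (s_exp (u n) (w n) (v n))"
        using K by (cases "s_factor s1 (s_exp (u n) (w n) (v n))") auto
      moreover have "ereal M \<le> ereal M'" by (simp add: M'_def)
      ultimately show ?case by (rule order.strict_trans1[rotated])
    qed
  qed
  then have "(\<lambda>n. s_factor s1 (s_exp (u n) (w n) (v n))) \<longlonglongrightarrow> \<infinity>" by (simp add: tendsto_PInfty)
  moreover have "\<forall>\<^sub>F n in sequentially. 1 \<le> s_exp (u n) (w n) (v n)"
    using X by eventually_elim (rule s_exp_ge_1)
  ultimately have "(\<lambda>n. s_exp (u n) (w n) (v n)) \<longlonglongrightarrow> ereal s1"
    by (simp add: s_factor_tendsto_PInfty_iff[OF s1])
  then show "?D x z powr s1 = ?D x y powr s1 + ?D y z powr s1"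
    using s_exp_tendsto_iff[OF X rn s1 lxz lxy lyz ord(3)] by blast
qed

text \<open>Triangles near \<open>p\<close> on which the product stays below \<open>M\<close> produce, after rescaling by their
  longest sides, a pretangent space containing a nondegenerate limit triangle.\<close>

lemma class_M_imp_limit_expr_large:
  fixes p :: "'a::metric_space"
  assumes s1: "0 < s1"
    and cM: "\<And>r S. normalizing r \<Longrightarrow> maximal_self_stable r S \<Longrightarrow> (\<lambda>_. p) \<in> S \<Longrightarrow>
            class_M (pt_space r S) (\<lambda>\<alpha> \<beta>. pt_dist r \<alpha> \<beta> powr s1)"
    and M: "0 < M"
  shows "\<exists>\<epsilon>>0. \<forall>x y z. (x, y, z) \<in> Xplus3 \<and>
            dist x p < \<epsilon> \<and> dist y p < \<epsilon> \<and> dist z p < \<epsilon> \<longrightarrow> limit_expr p s1 x y z > ereal M"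
proof (rule ccontr)
  assume "\<not> ?thesis"
  then have bad: "\<exists>x y z. (x, y, z) \<in> Xplus3 \<and> dist x p < \<epsilon> \<and> dist y p < \<epsilon> \<and> dist z p < \<epsilon> \<and>
      limit_expr p s1 x y z \<le> ereal M" if "\<epsilon> > 0" for \<epsilon>
    using that by (meson not_le)
  have "\<exists>x y z. (x, y, z) \<in> Xplus3 \<and> dist x p < inverse (real (Suc n)) \<and>
      dist y p < inverse (real (Suc n)) \<and> dist z p < inverse (real (Suc n)) \<and>
      limit_expr p s1 x y z \<le> ereal M" for n
    by (rule bad) simp
  then obtain x y z where X: "\<And>n. (x n, y n, z n) \<in> Xplus3"
    and xp: "\<And>n. dist (x n) p < inverse (real (Suc n))"
    and zp: "\<And>n. dist (z n) p < inverse (real (Suc n))"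
    and le: "\<And>n. limit_expr p s1 (x n) (y n) (z n) \<le> ereal M"
    by metis
  define D where "D n = dist (x n) (z n)" for n
  have ord: "0 < dist (y n) (z n)" "dist (y n) (z n) \<le> dist (x n) (y n)"
    "dist (x n) (y n) \<le> D n" "0 < D n" for n
    using X[of n] by (auto simp: Xplus3_def D_def)
  define \<kappa> where "\<kappa> = 1 / (1 + s1)\<^sup>2"
  have \<kappa>: "0 < \<kappa>" using s1 by (simp add: \<kappa>_def)
  define L where "L = M / \<kappa>"
  have L: "0 < L" using M \<kappa> by (simp add: L_def)
  define \<Phi> where "\<Phi> n = Phi_fun p (x n) (y n) (z n)" for n
  have \<Phi>: "0 < \<Phi> n" "\<Phi> n \<le> 2" for n
    using Phi_fun_pos[OF X] Phi_fun_le_2 by (auto simp: \<Phi>_def)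
  have G: "D n / dist (y n) (z n) / \<Phi> n \<le> L" for n
  proof -
    have "0 < D n / dist (y n) (z n) / \<Phi> n" using ord \<Phi> by simp
    then have "ereal (D n / dist (y n) (z n) / \<Phi> n) * ereal \<kappa>
        \<le> ereal (D n / dist (y n) (z n) / \<Phi> n) * s_factor s1 (s_exp (x n) (z n) (y n))"
      unfolding \<kappa>_def by (intro ereal_mult_left_mono s_factor_lower_bound s1 s_exp_ge_1 X) simp
    also have "\<dots> \<le> ereal M" using le[of n] by (simp add: limit_expr_Xplus3[OF X] D_def \<Phi>_def)
    finally show ?thesis using \<kappa> by (simp add: L_def pos_le_divide_eq)
  qed
  have Psi1: "1 \<le> D n / dist (y n) (z n)" for n
    using ord[of n] by simp
  have invPhi: "1 / \<Phi> n \<le> L" for n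
  proof -
    have "1 / \<Phi> n \<le> D n / dist (y n) (z n) / \<Phi> n"
      using Psi1[of n] \<Phi>(1)[of n] by (intro divide_right_mono) auto
    with G[of n] show ?thesis by linarith
  qed
  have shortest: "1 / (2 * L) \<le> dist (y n) (z n) / D n" for n
  proof -
    have "D n / dist (y n) (z n) \<le> L * \<Phi> n"
      using G[of n] unfolding pos_divide_le_eq[OF \<Phi>(1)] .
    also have "\<dots> \<le> L * 2" using \<Phi>(2) L by (intro mult_left_mono) auto
    finally have "D n / dist (y n) (z n) \<le> 2 * L" by simp
    then show ?thesis using ord[of n] L by (simp add: divide_simps mult.commute split: if_splits)
  qed
  have near: "dist q p / D n \<le> 1 + L" if "q \<in> {x n, y n, z n}" for q n
  proof -
    have "dist q p \<le> (1 + 1 / \<Phi> n) * D n"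
      using dist_le_Phi_fun[OF X that] by (simp add: \<Phi>_def D_def)
    also have "\<dots> \<le> (1 + L) * D n" using invPhi[of n] ord(4)[of n] by (intro mult_right_mono) auto
    finally show ?thesis using ord(4)[of n] by (simp add: pos_divide_le_eq)
  qed

  \<comment> \<open>Together with the longest side, rescaled to \<open>1\<close>, these are all the distances between the
    vertices and \<open>p\<close>; compactness makes them converge simultaneously.\<close>
  define T where "T n = (dist (x n) (y n) / D n, dist (y n) (z n) / D n, dist (x n) p / D n,
      dist (y n) p / D n, dist (z n) p / D n)" for n
  define B where "B = {0..1 + L} \<times> {0..1 + L} \<times> {0..1 + L} \<times> {0..1 + L} \<times> {0..1 + L}"
  have "T n \<in> B" for n
  proof -
    have "dist (x n) (y n) / D n \<le> 1" "dist (y n) (z n) / D n \<le> 1" using ord[of n] by auto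
    then have "dist (x n) (y n) / D n \<le> 1 + L" "dist (y n) (z n) / D n \<le> 1 + L"
      using L by linarith+
    then show ?thesis
      using near[of "x n" n] near[of "y n" n] near[of "z n" n] L ord(4)[of n] by (simp add: T_def B_def)
  qed
  moreover have "seq_compact B"
    unfolding B_def by (intro compact_imp_seq_compact compact_Times compact_Icc)
  ultimately obtain \<phi> l where \<phi>: "strict_mono \<phi>" and l: "(T \<circ> \<phi>) \<longlonglongrightarrow> l"
    unfolding seq_compact_def by blast
  define r where "r n = D (\<phi> n)" for n
  let ?x = "\<lambda>n. x (\<phi> n)" and ?y = "\<lambda>n. y (\<phi> n)" and ?z = "\<lambda>n. z (\<phi> n)" and ?p = "\<lambda>_::nat. p"
  obtain b c a1 a2 a3 where l': "l = (b, c, a1, a2, a3)" by (cases l) auto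
  have lims: "(\<lambda>n. dist (?x n) (?y n) / r n) \<longlonglongrightarrow> b" "(\<lambda>n. dist (?y n) (?z n) / r n) \<longlonglongrightarrow> c"
    "(\<lambda>n. dist (?x n) p / r n) \<longlonglongrightarrow> a1" "(\<lambda>n. dist (?y n) p / r n) \<longlonglongrightarrow> a2"
    "(\<lambda>n. dist (?z n) p / r n) \<longlonglongrightarrow> a3"
    using tendsto_fst[OF l] tendsto_fst[OF tendsto_snd[OF l]]
      tendsto_fst[OF tendsto_snd[OF tendsto_snd[OF l]]]
      tendsto_fst[OF tendsto_snd[OF tendsto_snd[OF tendsto_snd[OF l]]]]
      tendsto_snd[OF tendsto_snd[OF tendsto_snd[OF tendsto_snd[OF l]]]]
    by (simp_all add: T_def l' r_def)
  have rn: "0 < r n" for n by (simp add: r_def ord)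
  have limxz: "(\<lambda>n. dist (?x n) (?z n) / r n) \<longlonglongrightarrow> 1"
    using ord(4) by (simp add: r_def D_def less_imp_neq[symmetric])
  have r: "normalizing r"
  proof -
    have "D \<longlonglongrightarrow> 0"
    proof (rule tendsto_sandwich[of "\<lambda>_. 0" _ _ "\<lambda>n. 2 * inverse (real (Suc n))"])
      have "D n \<le> 2 * inverse (real (Suc n))" for n
        using xp[of n] zp[of n] dist_triangle2[of "x n" "z n" p] by (simp add: D_def)
      then show "\<forall>\<^sub>F n in sequentially. D n \<le> 2 * inverse (real (Suc n))" by simp
      show "(\<lambda>n. 2 * inverse (real (Suc n))) \<longlonglongrightarrow> 0"
        using tendsto_mult[OF tendsto_const[of 2] LIMSEQ_inverse_real_of_nat] by simp
    qed (auto simp: D_def)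
    then have "r \<longlonglongrightarrow> 0" unfolding r_def[abs_def]
      using LIMSEQ_subseq_LIMSEQ[OF _ \<phi>] by (auto simp: o_def)
    then show ?thesis using rn by (simp add: normalizing_def)
  qed
  have "self_stable r {?p, ?x, ?y, ?z}"
  proof -
    have st: "mutually_stable r f g \<and> mutually_stable r g f"
      if "(\<lambda>n. dist (f n) (g n) / r n) \<longlonglongrightarrow> q" for f g :: "nat \<Rightarrow> 'a" and q
      using that by (auto simp: mutually_stable_def convergent_def dist_commute)
    have "mutually_stable r f f" for f :: "nat \<Rightarrow> 'a"
      by (simp add: mutually_stable_def convergent_const)
    then show ?thesis
      using st[OF lims(1)] st[OF lims(2)] st[OF lims(3)] st[OF lims(4)] st[OF lims(5)] st[OF limxz]
      unfolding self_stable_def by simp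
  qed
  then obtain S where S: "{?p, ?x, ?y, ?z} \<subseteq> S" "maximal_self_stable r S"
    by (rule maximal_self_stable_extension)
  then have "class_M (pt_space r S) (\<lambda>\<alpha> \<beta>. pt_dist r \<alpha> \<beta> powr s1)"
    by (intro cM r) auto
  moreover have "self_stable r S" using S(2) by (simp add: maximal_self_stable_def)
  moreover have dt: "dtilde r ?x ?z = 1" "dtilde r ?x ?y = b" "dtilde r ?y ?z = c"
    using limI[OF limxz] limI[OF lims(1)] limI[OF lims(2)] by (simp_all add: dtilde_def)
  moreover have "1 / (2 * L) \<le> c"
    using shortest by (intro LIMSEQ_le_const[OF lims(2)]) (auto simp: r_def)
  then have c: "0 < c" using L by (meson less_le_trans zero_less_divide_1_iff zero_less_mult_iff zero_less_numeral)
  moreover have "c \<le> b"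
    using ord by (intro LIMSEQ_le[OF lims(2,1)]) (auto simp: r_def divide_right_mono less_imp_le)
  moreover have "b \<le> 1"
    using ord by (intro LIMSEQ_le_const2[OF lims(1)]) (auto simp: r_def)
  ultimately have "1 powr s1 = b powr s1 + c powr s1"
    using class_M_pt_space_iff[OF r _ s1, of S] S(1) by force
  then have "(\<lambda>n. s_exp (?x n) (?z n) (?y n)) \<longlonglongrightarrow> ereal s1"
    using s_exp_tendsto_iff[OF _ rn s1 limxz lims(1,2) c] X by simp
  then have "(\<lambda>n. s_factor s1 (s_exp (?x n) (?z n) (?y n))) \<longlonglongrightarrow> \<infinity>"
    using s_factor_tendsto_PInfty_iff[OF s1] s_exp_ge_1[OF X] by simp
  then have "\<forall>\<^sub>F n in sequentially. ereal (2 * M) < s_factor s1 (s_exp (?x n) (?z n) (?y n))"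
    by (simp add: tendsto_PInfty)
  then obtain n where n: "ereal (2 * M) < s_factor s1 (s_exp (?x n) (?z n) (?y n))"
    using eventually_happens' sequentially_bot by blast
  let ?G = "D (\<phi> n) / dist (?y n) (?z n) / \<Phi> (\<phi> n)"
  have "1 / 2 \<le> 1 / \<Phi> (\<phi> n)" using \<Phi>[of "\<phi> n"] by (intro divide_left_mono) auto
  also have "\<dots> \<le> ?G" using Psi1 \<Phi>(1)[of "\<phi> n"] by (intro divide_right_mono) auto
  finally have G2: "1 / 2 \<le> ?G" .
  have "ereal M < ereal (1 / 2) * s_factor s1 (s_exp (?x n) (?z n) (?y n))"
    using n by (cases "s_factor s1 (s_exp (?x n) (?z n) (?y n))") auto
  also have "\<dots> \<le> ereal ?G * s_factor s1 (s_exp (?x n) (?z n) (?y n))"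
  proof (rule ereal_mult_right_mono)
    have "0 \<le> ereal (2 * M)" using M by simp
    with n show "0 \<le> s_factor s1 (s_exp (?x n) (?z n) (?y n))" by (meson less_imp_le order_trans)
  qed (use G2 in simp)
  also have "\<dots> \<le> ereal M"
    using le[of "\<phi> n"] by (simp add: limit_expr_Xplus3[OF X] D_def \<Phi>_def)
  finally show False by simp
qed

theorem theorem3p2:
  fixes p :: "'a::metric_space" and s1 :: real
  assumes "p islimpt (UNIV :: 'a set)" and "s1 > 0"
  shows "(\<forall>r S. normalizing r \<and> maximal_self_stable r S \<and> (\<lambda>_. p) \<in> S \<longrightarrow>
            class_M (pt_space r S) (\<lambda>\<alpha> \<beta>. pt_dist r \<alpha> \<beta> powr s1))
     \<longleftrightarrow>
         (\<forall>M>0. \<exists>\<epsilon>>0. \<forall>x y z. (x, y, z) \<in> Xplus3 \<and>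
            dist x p < \<epsilon> \<and> dist y p < \<epsilon> \<and> dist z p < \<epsilon> \<longrightarrow>
            limit_expr p s1 x y z > ereal M)"
proof
  assume "\<forall>r S. normalizing r \<and> maximal_self_stable r S \<and> (\<lambda>_. p) \<in> S \<longrightarrow>
            class_M (pt_space r S) (\<lambda>\<alpha> \<beta>. pt_dist r \<alpha> \<beta> powr s1)"
  then show "\<forall>M>0. \<exists>\<epsilon>>0. \<forall>x y z. (x, y, z) \<in> Xplus3 \<and>
            dist x p < \<epsilon> \<and> dist y p < \<epsilon> \<and> dist z p < \<epsilon> \<longrightarrow>
            limit_expr p s1 x y z > ereal M"
    using class_M_imp_limit_expr_large[OF assms(2)] by blast
next
  assume L: "\<forall>M>0. \<exists>\<epsilon>>0. \<forall>x y z. (x, y, z) \<in> Xplus3 \<and>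
            dist x p < \<epsilon> \<and> dist y p < \<epsilon> \<and> dist z p < \<epsilon> \<longrightarrow>
            limit_expr p s1 x y z > ereal M"
  show "\<forall>r S. normalizing r \<and> maximal_self_stable r S \<and> (\<lambda>_. p) \<in> S \<longrightarrow>
            class_M (pt_space r S) (\<lambda>\<alpha> \<beta>. pt_dist r \<alpha> \<beta> powr s1)"
    using limit_expr_large_imp_class_M[OF assms(2) L[rule_format]]
    by (simp add: maximal_self_stable_def)
qed

end
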